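(* Let $I \supset [0,\infty)$ be an open interval and let $f : I \to (0,\infty)$ be differentiable. Let $a \in [0,\infty)$, $b \ge 1$, $a<b$, $q\ge 1$, $\alpha\in(0,1]$ and $m\in(0,1)$. Suppose that $f' \in L[a,b]$, that $|f'|^{q}$ is decreasing and $(\alpha,m)$-geometrically convex on $[\min\{1,a\},b]$, and that $|f'(y)| \le M < 1$ for all $y \in [\min\{1,a\},b]$. Then for every $\mu>0$ and every $x \in [a,b]$, $$\left| \frac{(x-a)^{\mu}+(b-x)^{\mu}}{b-a} f(x) - \frac{\Gamma(\mu+1)}{b-a}\left[ J_{x^-}^{\mu} f(a) + J_{x^+}^{\mu} f(b) \right] \right| \le M^{m}\left(\frac{1}{\mu+1}\right)^{1-\frac1q}\left(\int_0^1 t^{\mu}M^{qt\alpha(1-m)}\,dt\right)^{\frac1q}\left[ \frac{(x-a)^{\mu+1}+(b-x)^{\mu+1}}{b-a} \right].$$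
   Context: Let $(\alpha,m)\in(0,1]\times(0,1]$. A positive function $g$ is $(\alpha,m)$-geometrically convex on an interval $J\subset[0,\infty)$ if $g\left(x^{t}y^{m(1-t)}\right) \le [g(x)]^{t^{\alpha}}[g(y)]^{m(1-t^{\alpha})}$ for all $x,y\in J$ and $t\in[0,1]$. $L[a,b]$ denotes the Lebesgue integrable functions on $[a,b]$, and $\Gamma$ is the Gamma function. The Riemann-Liouville fractional integrals of order $\mu>0$ are $J_{c^+}^{\mu} f(x)=\frac{1}{\Gamma(\mu)}\int_c^x (x-t)^{\mu-1}f(t)\,dt$ for $x>c$ and $J_{d^-}^{\mu} f(x)=\frac{1}{\Gamma(\mu)}\int_x^d (t-x)^{\mu-1}f(t)\,dt$ for $x<d$. Thus $J_{x^-}^{\mu} f(a)=\frac{1}{\Gamma(\mu)}\int_a^x (t-a)^{\mu-1}f(t)\,dt$ and $J_{x^+}^{\mu} f(b)=\frac{1}{\Gamma(\mu)}\int_x^b (b-t)^{\mu-1}f(t)\,dt$ (each being $0$ when the integration interval is a point). *)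

theory Defs
  imports "HOL-Analysis.Analysis"
begin

text \<open>
  Real power with \<open>0\<^sup>0 = 1\<close>. The library has \<open>0 powr 0 = 0\<close>, which would turn the geometric mean
  \<open>x\<^sup>t y\<^bsup>m(1-t)\<^esup>\<close> into \<open>0\<close> at the corner cases \<open>x = 0, t = 0\<close> and \<open>y = 0, t = 1\<close>.
\<close>

definition rpow :: "real \<Rightarrow> real \<Rightarrow> real" where
  "rpow x s = (if s = 0 then 1 else x powr s)"

text \<open>
  Plain \<open>powr\<close> suffices on the right-hand side: the bases \<open>g x\<close>, \<open>g y\<close> are positive, and
  \<open>0 powr \<alpha> = 0\<close> is the intended value of \<open>t\<^sup>\<alpha>\<close> at \<open>t = 0\<close> because \<open>\<alpha> > 0\<close>.
\<close>

definition geometrically_convex_on ::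
    "real \<Rightarrow> real \<Rightarrow> real set \<Rightarrow> (real \<Rightarrow> real) \<Rightarrow> bool" where
  "geometrically_convex_on \<alpha> m J g \<longleftrightarrow>
     is_interval J \<and> J \<subseteq> {0..} \<and> (\<forall>x\<in>J. 0 < g x) \<and>
     (\<forall>x\<in>J. \<forall>y\<in>J. \<forall>t\<in>{0..1}.
        g (rpow x t * rpow y (m * (1 - t)))
          \<le> g x powr (t powr \<alpha>) * g y powr (m * (1 - t powr \<alpha>)))"

text \<open>
  Riemann--Liouville integrals \<open>J\<^bsub>c+\<^esub>\<^sup>\<mu> f(x)\<close> and \<open>J\<^bsub>d-\<^esub>\<^sup>\<mu> f(x)\<close>. For \<open>\<mu> < 1\<close> the kernel is singular
  at \<open>t = x\<close>; its value there under \<open>powr\<close> is irrelevant, being on a null set.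
\<close>

definition RL_left :: "real \<Rightarrow> real \<Rightarrow> (real \<Rightarrow> real) \<Rightarrow> real \<Rightarrow> real" where
  "RL_left \<mu> c f x =
     1 / Gamma \<mu> * (LINT t:{c..x}|lebesgue. (x - t) powr (\<mu> - 1) * f t)"

definition RL_right :: "real \<Rightarrow> real \<Rightarrow> (real \<Rightarrow> real) \<Rightarrow> real \<Rightarrow> real" where
  "RL_right \<mu> d f x =
     1 / Gamma \<mu> * (LINT t:{x..d}|lebesgue. (t - x) powr (\<mu> - 1) * f t)"

end

theory Submission
  imports Defs
begin

text \<open>
  Since \<open>t\<alpha> \<le> 1\<close> and \<open>0 < M < 1\<close>, the bound \<open>M\<close> on \<open>\<bar>f'\<bar>\<close> is at most
  \<open>M\<^sup>m M\<^bsup>t\<alpha>(1-m)\<^esup>\<close>. So the right-hand side is at least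
  \<open>M / (\<mu> + 1)\<close> times its last factor, and this smaller quantity bounds the left-hand side for any
  \<open>M\<close>-Lipschitz function: \<open>(x - a)\<^sup>\<mu> f(x) - \<Gamma>(\<mu> + 1) J\<^sup>\<mu>f(a)\<close> is the integral of
  \<open>\<mu> (t - a)\<^bsup>\<mu>-1\<^esup> (f(x) - f(t))\<close> over \<open>[a, x]\<close>, and the other half is its mirror image.
\<close>

lemma has_integral_powr_shifted:
  fixes a x \<mu> :: real
  assumes "0 < \<mu>" "a \<le> x"
  shows "((\<lambda>t. (t - a) powr (\<mu> - 1)) has_integral (x - a) powr \<mu> / \<mu>) {a..x}"
  using has_integral_shift_real_ivl[OF has_integral_powr_from_0[of "\<mu> - 1" "x - a"], of "- a"] assms
  by simp

text \<open>The kernel is nonnegative with a finite integral, hence absolutely integrable despite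
  its singularity at \<open>a\<close> when \<mu> < 1. A continuous \<open>f\<close> on a compact
  interval is bounded and measurable, and multiplying by such a function preserves absolute
  integrability.\<close>

lemma set_integrable_powr_shifted_mult:
  fixes f :: "real \<Rightarrow> real"
  assumes "0 < \<mu>" "a \<le> x" "continuous_on {a..x} f"
  shows "set_integrable lebesgue {a..x} (\<lambda>t. (t - a) powr (\<mu> - 1) * f t)"
proof -
  have "(\<lambda>t. (t - a) powr (\<mu> - 1)) absolutely_integrable_on {a..x}"
    using has_integral_powr_shifted[OF assms(1,2)]
    by (intro nonnegative_absolutely_integrable_1) auto
  moreover have "f \<in> borel_measurable (lebesgue_on {a..x})"
    by (rule continuous_imp_measurable_on_sets_lebesgue) (use assms in auto)
  moreover have "bounded (f ` {a..x})"
    using assms(3) compact_continuous_image compact_imp_bounded by blast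
  ultimately have "(\<lambda>t. f t * (t - a) powr (\<mu> - 1)) absolutely_integrable_on {a..x}"
    by (intro absolutely_integrable_bounded_measurable_product_real) auto
  then show ?thesis
    by (simp add: mult.commute)
qed

text \<open>The recurrence \<open>Gamma (\<mu> + 1) = \<mu> * Gamma \<mu>\<close> absorbs the
  normalising factor. The Lebesgue integral becomes a gauge integral, to which the
  \<open>has_integral\<close> rules apply.\<close>

lemma Gamma_mult_RL_right_eq:
  fixes f :: "real \<Rightarrow> real"
  assumes "0 < \<mu>" "a \<le> x" "continuous_on {a..x} f"
  shows "Gamma (\<mu> + 1) * RL_right \<mu> x f a
    = \<mu> * integral {a..x} (\<lambda>t. (t - a) powr (\<mu> - 1) * f t)"
proof -
  have "Gamma (\<mu> + 1) = \<mu> * Gamma \<mu>"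
    using assms(1) by (intro Gamma_plus1) (auto elim!: nonpos_Ints_cases)
  moreover have "Gamma \<mu> > 0"
    using assms(1) by (rule Gamma_real_pos)
  ultimately show ?thesis
    unfolding RL_right_def
    using set_lebesgue_integral_eq_integral(2)[OF set_integrable_powr_shifted_mult[OF assms]]
    by simp
qed

text \<open>The substitution of -t for t moves the singular endpoint of the kernel from right to
  left, so only one of the two Lipschitz estimates has to be computed.\<close>

lemma RL_left_eq_RL_right_reflect:
  "RL_left \<mu> c f x = RL_right \<mu> (- c) (\<lambda>t. f (- t)) (- x)"
proof -
  have "(LINT t:{c..x}|lebesgue. (x - t) powr (\<mu> - 1) * f t)
      = (LINT t:{- x..- c}|lebesgue. (t + x) powr (\<mu> - 1) * f (- t))"
    unfolding set_lebesgue_integral_def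
    by (subst lebesgue_integral_real_affine[of "-1" _ 0])
      (auto intro!: Bochner_Integration.integral_cong simp: indicator_def algebra_simps)
  then show ?thesis
    by (simp add: RL_left_def RL_right_def)
qed

text \<open>With \<open>K\<close> the kernel, the Lipschitz condition bounds
  \<open>K t * (f x - f t)\<close> by \<open>M * K t * (x - t)\<close>. The integral of
  \<open>K t * (x - t)\<close> is \<open>(x - a) powr (\<mu> + 1)\<close> times the Beta value
  B(\<mu>, 2) = 1 / (\<mu> (\<mu> + 1)), and the prefactor \<mu> cancels one factor.\<close>

lemma RL_right_Lipschitz_bound:
  fixes f :: "real \<Rightarrow> real"
  assumes \<mu>: "0 < \<mu>" and ax: "a \<le> x"
    and lip: "\<And>s t. s \<in> {a..x} \<Longrightarrow> t \<in> {a..x} \<Longrightarrow> \<bar>f s - f t\<bar> \<le> M * \<bar>s - t\<bar>"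
    and cont: "continuous_on {a..x} f"
  shows "\<bar>(x - a) powr \<mu> * f x - Gamma (\<mu> + 1) * RL_right \<mu> x f a\<bar>
    \<le> M / (\<mu> + 1) * (x - a) powr (\<mu> + 1)"
proof -
  define K where "K = (\<lambda>t. (t - a) powr (\<mu> - 1))"
  define J where "J = integral {a..x} (\<lambda>t. K t * f t)"
  have K: "(K has_integral (x - a) powr \<mu> / \<mu>) {a..x}"
    using has_integral_powr_shifted[OF \<mu> ax] by (simp add: K_def)
  have "((\<lambda>t. K t * f t) has_integral J) {a..x}"
    unfolding J_def K_def
    by (intro integrable_integral set_lebesgue_integral_eq_integral
        set_integrable_powr_shifted_mult \<mu> ax cont)
  then have diff: "((\<lambda>t. K t * (f x - f t)) has_integral (x - a) powr \<mu> / \<mu> * f x - J) {a..x}"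
    using has_integral_diff[OF has_integral_mult_left[OF K, of "f x"]]
    by (simp add: algebra_simps)
  \<comment> \<open>This is the majorant \<open>M * K t * (x - t)\<close>. Writing
    \<open>x - t\<close> as \<open>(x - a) - (t - a)\<close> turns its integral into a difference of
    two known power integrals.\<close>
  have "((\<lambda>t. M * ((x - a) * K t - (t - a) powr \<mu>)) has_integral
      M * ((x - a) * ((x - a) powr \<mu> / \<mu>) - (x - a) powr (\<mu> + 1) / (\<mu> + 1))) {a..x}"
    using has_integral_powr_shifted[of "\<mu> + 1" a x] \<mu> ax
    by (intro has_integral_mult_right has_integral_diff K) auto
  moreover have "(x - a) * ((x - a) powr \<mu> / \<mu>) - (x - a) powr (\<mu> + 1) / (\<mu> + 1)
      = (x - a) powr (\<mu> + 1) / (\<mu> * (\<mu> + 1))"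
    using \<mu> ax by (simp add: powr_add field_simps)
  ultimately have bound: "((\<lambda>t. M * ((x - a) * K t - (t - a) powr \<mu>)) has_integral
      M * ((x - a) powr (\<mu> + 1) / (\<mu> * (\<mu> + 1)))) {a..x}"
    by simp
  have le: "norm (K t * (f x - f t)) \<le> M * ((x - a) * K t - (t - a) powr \<mu>)" if "t \<in> {a..x}" for t
  proof -
    \<comment> \<open>This holds at \<open>t = a\<close> too: both sides are 0 there, because
      \<open>0 powr \<mu> = 0\<close>.\<close>
    have "(t - a) powr \<mu> = (t - a) * K t"
      using that powr_add[of "t - a" "\<mu> - 1" 1] by (auto simp: K_def)
    moreover have "\<bar>f x - f t\<bar> \<le> M * (x - t)"
      using lip[of x t] that by auto
    then have "K t * \<bar>f x - f t\<bar> \<le> K t * (M * (x - t))"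
      by (intro mult_left_mono) (auto simp: K_def)
    moreover have "norm (K t * (f x - f t)) = K t * \<bar>f x - f t\<bar>"
      by (simp add: abs_mult K_def)
    ultimately show ?thesis
      by (simp add: algebra_simps)
  qed
  have "\<bar>(x - a) powr \<mu> / \<mu> * f x - J\<bar> \<le> M * ((x - a) powr (\<mu> + 1) / (\<mu> * (\<mu> + 1)))"
    using integral_norm_bound_integral[of "\<lambda>t. K t * (f x - f t)" "{a..x}"] diff bound le
    by (metis (no_types, lifting) has_integral_integrable integral_unique real_norm_def)
  then have "\<mu> * \<bar>(x - a) powr \<mu> / \<mu> * f x - J\<bar>
      \<le> \<mu> * (M * ((x - a) powr (\<mu> + 1) / (\<mu> * (\<mu> + 1))))"
    using \<mu> by (intro mult_left_mono) auto
  also have "\<dots> = M / (\<mu> + 1) * (x - a) powr (\<mu> + 1)"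
    using \<mu> by simp
  also have "\<mu> * \<bar>(x - a) powr \<mu> / \<mu> * f x - J\<bar> = \<bar>\<mu> * ((x - a) powr \<mu> / \<mu> * f x - J)\<bar>"
    using \<mu> by (simp add: abs_mult)
  also have "\<mu> * ((x - a) powr \<mu> / \<mu> * f x - J) = (x - a) powr \<mu> * f x - \<mu> * J"
    using \<mu> by (simp add: field_simps)
  finally show ?thesis
    using Gamma_mult_RL_right_eq[OF \<mu> ax cont] by (simp add: J_def K_def)
qed

text \<open>Reflection preserves the Lipschitz constant and carries [x, b] to [-b, -x], where the
  previous estimate applies.\<close>

lemma RL_left_Lipschitz_bound:
  fixes f :: "real \<Rightarrow> real"
  assumes \<mu>: "0 < \<mu>" and xb: "x \<le> b"
    and lip: "\<And>s t. s \<in> {x..b} \<Longrightarrow> t \<in> {x..b} \<Longrightarrow> \<bar>f s - f t\<bar> \<le> M * \<bar>s - t\<bar>"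
    and cont: "continuous_on {x..b} f"
  shows "\<bar>(b - x) powr \<mu> * f x - Gamma (\<mu> + 1) * RL_left \<mu> x f b\<bar>
    \<le> M / (\<mu> + 1) * (b - x) powr (\<mu> + 1)"
proof -
  have lip': "\<bar>f (- s) - f (- t)\<bar> \<le> M * \<bar>s - t\<bar>" if "s \<in> {- b..- x}" "t \<in> {- b..- x}" for s t
    using lip[of "- s" "- t"] that by (auto simp: abs_minus_commute)
  have cont': "continuous_on {- b..- x} (\<lambda>t. f (- t))"
    by (rule continuous_on_compose2[OF cont]) (auto intro!: continuous_intros)
  show ?thesis
    using RL_right_Lipschitz_bound[of \<mu> "- b" "- x" "\<lambda>t. f (- t)" M] \<mu> xb lip' cont'
    by (simp add: RL_left_eq_RL_right_reflect)
qed

text \<open>A power with base \<open>M < 1\<close> decreases in its exponent, so replacing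
  \<open>t * \<alpha>\<close> by its upper bound 1 makes the integrand smaller. What remains
  integrates to \<open>M powr (q * (1 - m)) / (\<mu> + 1)\<close>.\<close>

lemma le_powr_mean_factor:
  fixes \<alpha> m M \<mu> q :: real
  assumes "0 < M" "M < 1" "0 < \<mu>" "1 \<le> q" "0 < \<alpha>" "\<alpha> \<le> 1" "m < 1"
  shows "M / (\<mu> + 1) \<le> M powr m * (1 / (\<mu> + 1)) powr (1 - 1 / q)
    * (LINT t:{0..1}|lebesgue. t powr \<mu> * M powr (q * t * \<alpha> * (1 - m))) powr (1 / q)"
    (is "_ \<le> _ * ?I powr _")
proof -
  have cont: "continuous_on {0..1} (\<lambda>t. M powr (q * t * \<alpha> * (1 - m)))"
    using assms by (intro continuous_intros) auto
  \<comment> \<open>Here \<open>t powr \<mu>\<close> is the earlier kernel with \<open>a = 0\<close>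
    and \<mu> + 1 in place of \<mu>.\<close>
  have int: "set_integrable lebesgue {0..1} (\<lambda>t. t powr \<mu> * h t)"
    if "continuous_on {0..1} h" for h :: "real \<Rightarrow> real"
    using set_integrable_powr_shifted_mult[of "\<mu> + 1" 0 1 h] that assms by simp
  have "((\<lambda>t. t powr \<mu> * M powr (q * (1 - m))) has_integral
      1 / (\<mu> + 1) * M powr (q * (1 - m))) {0..1}"
    using has_integral_mult_left[OF has_integral_powr_from_0[of \<mu> 1]] assms by simp
  then have "1 / (\<mu> + 1) * M powr (q * (1 - m))
      = (LINT t:{0..1}|lebesgue. t powr \<mu> * M powr (q * (1 - m)))"
    using set_lebesgue_integral_eq_integral(2)[OF int[of "\<lambda>_. M powr (q * (1 - m))"]]
    by (metis continuous_on_const integral_unique)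
  also have "\<dots> \<le> ?I"
  proof (rule set_integral_mono)
    fix t :: real assume t: "t \<in> {0..1}"
    have "t * \<alpha> \<le> 1"
      using t assms mult_mono[of t 1 \<alpha> 1] by auto
    then have "(q * (1 - m)) * (t * \<alpha>) \<le> (q * (1 - m)) * 1"
      using assms by (intro mult_left_mono) auto
    then show "t powr \<mu> * M powr (q * (1 - m)) \<le> t powr \<mu> * M powr (q * t * \<alpha> * (1 - m))"
      using assms by (intro mult_left_mono powr_mono') (auto simp: mult_ac)
  qed (use int cont in auto)
  finally have I: "(1 / (\<mu> + 1) * M powr (q * (1 - m))) powr (1 / q) \<le> ?I powr (1 / q)"
    using assms by (intro powr_mono2) auto
  have "(1 / (\<mu> + 1) * M powr (q * (1 - m))) powr (1 / q)
      = (1 / (\<mu> + 1)) powr (1 / q) * M powr (1 - m)"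
    using assms by (simp add: powr_mult powr_powr powr_divide)
  \<comment> \<open>Grouped by base, the exponents m and 1 - m, and likewise 1 - 1/q and 1/q, sum to
    1, which leaves exactly \<open>M / (\<mu> + 1)\<close>.\<close>
  then have "M powr m * (1 / (\<mu> + 1)) powr (1 - 1 / q)
        * (1 / (\<mu> + 1) * M powr (q * (1 - m))) powr (1 / q)
      = (M powr m * M powr (1 - m))
        * ((1 / (\<mu> + 1)) powr (1 - 1 / q) * (1 / (\<mu> + 1)) powr (1 / q))"
    by (simp only: mult_ac)
  also have "\<dots> = M / (\<mu> + 1)"
    using assms by (simp only: powr_add[symmetric]) simp
  finally show ?thesis
    using mult_left_mono[OF I, of "M powr m * (1 / (\<mu> + 1)) powr (1 - 1 / q)"] by simp
qed

theorem theorem4: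
  fixes f :: "real \<Rightarrow> real" and I :: "real set"
    and a b q \<alpha> m M \<mu> x :: real
  assumes "open I" and "is_interval I" and "{0..} \<subseteq> I"
    and "\<And>y. y \<in> I \<Longrightarrow> 0 < f y"
    and "f differentiable_on I"
    and "0 \<le> a" and "1 \<le> b" and "a < b"
    and "1 \<le> q"
    and "0 < \<alpha>" and "\<alpha> \<le> 1"
    and "0 < m" and "m < 1"
    and "set_integrable lebesgue {a..b} (deriv f)"
    and "antimono_on {min 1 a..b} (\<lambda>y. \<bar>deriv f y\<bar> powr q)"
    and "geometrically_convex_on \<alpha> m {min 1 a..b} (\<lambda>y. \<bar>deriv f y\<bar> powr q)"
    and "\<And>y. y \<in> {min 1 a..b} \<Longrightarrow> \<bar>deriv f y\<bar> \<le> M"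
    and "M < 1"
    and "0 < \<mu>"
    and "x \<in> {a..b}"
  shows "\<bar>((x - a) powr \<mu> + (b - x) powr \<mu>) / (b - a) * f x
           - Gamma (\<mu> + 1) / (b - a) * (RL_right \<mu> x f a + RL_left \<mu> x f b)\<bar>
         \<le> M powr m * (1 / (\<mu> + 1)) powr (1 - 1 / q)
            * (LINT t:{0..1}|lebesgue. t powr \<mu> * M powr (q * t * \<alpha> * (1 - m))) powr (1 / q)
            * (((x - a) powr (\<mu> + 1) + (b - x) powr (\<mu> + 1)) / (b - a))"
proof -
  note a = \<open>0 \<le> a\<close> and \<mu> = \<open>0 < \<mu>\<close> and x = \<open>x \<in> {a..b}\<close> and ab = \<open>a < b\<close>
  let ?A = "(x - a) powr \<mu>" and ?B = "(b - x) powr \<mu>"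
  let ?R = "Gamma (\<mu> + 1) * RL_right \<mu> x f a" and ?L = "Gamma (\<mu> + 1) * RL_left \<mu> x f b"
  let ?S = "((x - a) powr (\<mu> + 1) + (b - x) powr (\<mu> + 1)) / (b - a)"
  \<comment> \<open>Since [a, b] lies in the open set \<open>I\<close>, differentiability is
    two-sided even at the endpoints, and \<open>deriv f\<close> is the actual derivative
    there.\<close>
  have deriv: "(f has_field_derivative deriv f y) (at y within S)" if "y \<in> {a..b}" for y S
  proof -
    have "y \<in> I"
      using that a assms(3) by auto
    then have "f differentiable at y"
      using assms(1,5) by (simp add: differentiable_on_eq_differentiable_at)
    then show ?thesis
      using DERIV_deriv_iff_real_differentiable has_field_derivative_at_within by blast
  qed
  have bound: "norm (deriv f y) \<le> M" if "y \<in> {a..b}" for y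
    using assms(17)[of y] that by auto
  have lip: "\<bar>f s - f t\<bar> \<le> M * \<bar>s - t\<bar>" if "s \<in> {a..b}" "t \<in> {a..b}" for s t
    using field_differentiable_bound[of "{a..b}" f "deriv f" M] deriv bound that by auto
  have cont: "continuous_on {a..b} f"
    using deriv by (rule DERIV_continuous_on)
  \<comment> \<open>Geometric convexity includes positivity of the function. As
    \<open>0 powr q = 0\<close>, this forces \<open>deriv f b\<close> to be nonzero, and so 0 <
    \<open>M\<close>, as \<open>le_powr_mean_factor\<close> requires.\<close>
  have "0 < \<bar>deriv f b\<bar> powr q"
    using assms(16) ab unfolding geometrically_convex_on_def by auto
  moreover have "\<bar>deriv f b\<bar> \<le> M"
    using bound[of b] ab by auto
  ultimately have "0 < M"
    by (cases "deriv f b = 0") auto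
  \<comment> \<open>Each fractional integral is paired with the power of the distance from
    \<open>x\<close> to its own endpoint; the triangle inequality then adds the two halves.\<close>
  have "\<bar>?A * f x - ?R\<bar> \<le> M / (\<mu> + 1) * (x - a) powr (\<mu> + 1)"
    using x by (intro RL_right_Lipschitz_bound \<mu> lip continuous_on_subset[OF cont]) auto
  moreover have "\<bar>?B * f x - ?L\<bar> \<le> M / (\<mu> + 1) * (b - x) powr (\<mu> + 1)"
    using x by (intro RL_left_Lipschitz_bound \<mu> lip continuous_on_subset[OF cont]) auto
  ultimately have *: "\<bar>(?A * f x - ?R) + (?B * f x - ?L)\<bar>
      \<le> M / (\<mu> + 1) * ((x - a) powr (\<mu> + 1) + (b - x) powr (\<mu> + 1))"
    unfolding distrib_left by linarith
  have "(?A + ?B) / (b - a) * f x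
        - Gamma (\<mu> + 1) / (b - a) * (RL_right \<mu> x f a + RL_left \<mu> x f b)
      = ((?A * f x - ?R) + (?B * f x - ?L)) / (b - a)"
    using ab by (simp add: divide_simps) (simp add: algebra_simps)
  then have "\<bar>(?A + ?B) / (b - a) * f x
        - Gamma (\<mu> + 1) / (b - a) * (RL_right \<mu> x f a + RL_left \<mu> x f b)\<bar>
      \<le> M / (\<mu> + 1) * ?S"
    using divide_right_mono[OF *, of "b - a"] ab by (simp add: abs_divide)
  also have "\<dots> \<le> M powr m * (1 / (\<mu> + 1)) powr (1 - 1 / q)
      * (LINT t:{0..1}|lebesgue. t powr \<mu> * M powr (q * t * \<alpha> * (1 - m))) powr (1 / q) * ?S"
    using assms \<open>0 < M\<close> by (intro mult_right_mono le_powr_mean_factor) auto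
  finally show ?thesis .
qed

end
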